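(* Let $f\colon[0,1]\to[0,1]$ be an expanding Lorenz map and $n\in\mathbb{N}$. Assume that there is a sequence of Lorenz maps $\{f_i\}_{i=1}^n$ such that for every $i=1,2,\ldots,n$ the map $f_i\colon[u_i,v_i]\to[u_i,v_i]$ has one of the following forms: $$f_i=(f_{i-1},f_{i-1}^2),\quad f_i=(f_{i-1}^2,f_{i-1})\quad\text{or}\quad f_i=(f_{i-1}^2,f_{i-1}^2),$$ where $f_0:=f$. (It is not assumed that the $f_i$ are proper renormalizations: it may happen that $[u_i,v_i]=[u_{i-1},v_{i-1}]$ and $f_i$ is a special trivial renormalization of $f_{i-1}$.) Then for every $i=1,\ldots,n$ there exist numbers $l_i,r_i\in\mathbb{N}$ such that $f_i=(f_0^{l_i},f_0^{r_i})$. Moreover, the following trichotomy holds. (1) The map $f_n$ is the composition of $n$ trivial renormalizations, i.e. $f_i\neq(f_{i-1}^2,f_{i-1}^2)$ for every $i=1,\ldots,n$. Then $J_{f_n}\subset\{0,1\}$ and $l_n\neq r_n$. (2) We have $f_n=(f_{n-1}^2,f_{n-1}^2)$. Then the set $J_{f_n}$ contains a periodic orbit, $R_{J_{f_n}}f=f_n$ and $l_n=r_n$. (3) We have $f_n\neq(f_{n-1}^2,f_{n-1}^2)$ and $f_i=(f_{i-1}^2,f_{i-1}^2)$ for some $i<n$. Then the set $J_{f_n}$ contains a periodic orbit, but $R_{J_{f_n}}f\neq f_n$ and $l_n\neq r_n$. In fact $R_{J_{f_n}}f=f_j$, where $0<j<n$ is the largest index for which the map $f_j$ is neither a trivial nor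 a special trivial renormalization of $f_{j-1}$ (i.e. the largest $j$ with $f_j=(f_{j-1}^2,f_{j-1}^2)$).
   Context: **Expanding Lorenz map.** A map $f\colon[0,1]\to[0,1]$ such that: (i) there is a critical point $c\in(0,1)$ such that $f$ is continuous and strictly increasing on $[0,c)$ and on $(c,1]$; (ii) $\lim_{x\to c^-}f(x)=1$ and $\lim_{x\to c^+}f(x)=0$; (iii) $f$ is differentiable outside a finite set $F\subseteq[0,1]$ and $\inf_{x\notin F}f'(x)>1$. The value $f(c)$ is taken to be $0$ or $1$ (either choice). $f^n(a_+)$, $f^n(a_-)$ denote the right and left one-sided limits of $f^n$ at $a$. $\mathrm{Orb}(x)$ is the forward orbit of $x$ under $f$, including $x$. A map is a Lorenz map on $[u,v]$ if conjugating it by the increasing linear homeomorphism $[u,v]\to[0,1]$ gives an (expanding) Lorenz map on $[0,1]$. $\mathbb{N}$ is the set of positive integers. **Notation $(h^a,h^b)$.** If $h$ is a Lorenz map on $[u',v']$ with critical point $c$, the expression $g=(h^a,h^b)$ ($a,b\in\mathbb{N}$) means that $g\colon[u,v]\to[u,v]$ is a Lorenz map on an interval $[u,v]\subset[u',v']$ with $c\in(u,v)$, with critical point $c$, given by $g(x)=h^a(x)$ for $x\in[u,c)$ and $g(x)=h^b(x)$ for $x\in(c,v]$; necessarily $u=h^b(c_+)$, $v=h^a(c_-)$. If the orbit of an endpoint hits $c$, the endpoint values are understood as $g(u)=h^a(u_+)$ and $g(v)=h^b(v_-)$. Here $[u_0,v_0]=[0,1]$. The map $g$ is a (trivial) renormalization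 of $h$ when $(a,b)=(1,2)$ or $(2,1)$ and $(u,v)$ is a proper subinterval of $(u',v')$; in the case $(a,b)\in\{(1,2),(2,1)\}$ where an endpoint of $[u',v']$ is fixed by $h$ or mapped by $h$ to $c$, it is called a special trivial renormalization (then $[u,v]=[u',v']$ is possible). **The set $J_{f_i}$.** $J_{f_i}=\{x\in[0,1]:\mathrm{Orb}(x)\cap(u_i,v_i)=\emptyset\}$, with orbits under $f=f_0$. **The map $R_Ef$.** For a nonempty open interval $U\subset[0,1]$ let $N(U)=\min\{n\ge0: f^n(z)=c\text{ for some }z\in U\}$. For a closed set $E\subset[0,1]$ put $e_-=\sup\{x\in E:x<c\}$, $e_+=\inf\{x\in E:x>c\}$, $l=N((e_-,c))$, $r=N((c,e_+))$, and $$R_Ef(x)=\begin{cases}f^l(x),&x\in[f^r(c_+),c)\\ f^r(x),&x\in(c,f^l(c_-)].\end{cases}$$ *)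

theory Defs
  imports "HOL-Analysis.Analysis"
begin

(* The existence of a bound k > 1 says that the infimum of f' off F exceeds 1; the real-valued
   Inf is avoided, being meaningful only for sets that are bounded below. Derivatives at 0 and 1
   are one-sided. The value f c is either 0 or 1 and carries no information. *)
definition expanding_lorenz :: "(real \<Rightarrow> real) \<Rightarrow> real \<Rightarrow> bool" where
  "expanding_lorenz f c \<longleftrightarrow>
     f ` {0..1} \<subseteq> {0..1} \<and>
     0 < c \<and> c < 1 \<and>
     continuous_on {0..<c} f \<and> strict_mono_on {0..<c} f \<and>
     continuous_on {c<..1} f \<and> strict_mono_on {c<..1} f \<and>
     (f \<longlongrightarrow> 1) (at_left c) \<and> (f \<longlongrightarrow> 0) (at_right c) \<and>
     (f c = 0 \<or> f c = 1) \<and>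
     (\<exists>F k. finite F \<and> F \<subseteq> {0..1} \<and> k > 1 \<and>
        (\<forall>x\<in>{0..1} - F. \<exists>D\<ge>k. (f has_real_derivative D) (at x within {0..1})))"

definition lorenz_on :: "real \<Rightarrow> real \<Rightarrow> (real \<Rightarrow> real) \<Rightarrow> real \<Rightarrow> bool" where
  "lorenz_on u v g c \<longleftrightarrow>
     u < v \<and> expanding_lorenz (\<lambda>t. (g (u + (v - u) * t) - u) / (v - u)) ((c - u) / (v - u))"

(* g = (h^a, h^b), where h is a Lorenz map on [u', v'] with critical point c and g lives on [u, v].
   The endpoint values are h^a(u+) and h^b(v-); they agree with h^a(u) and h^b(v) unless the orbit
   of the endpoint hits c. The value of g at c is not constrained beyond being u or v. *)
definition lorenz_pair ::
  "real \<Rightarrow> real \<Rightarrow> (real \<Rightarrow> real) \<Rightarrow> real \<Rightarrow> nat \<Rightarrow> nat \<Rightarrow> real \<Rightarrow> real \<Rightarrow> (real \<Rightarrow> real) \<Rightarrow> bool" where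
  "lorenz_pair u' v' h c a b u v g \<longleftrightarrow>
     a \<ge> 1 \<and> b \<ge> 1 \<and> {u..v} \<subseteq> {u'..v'} \<and> u < c \<and> c < v \<and> lorenz_on u v g c \<and>
     (\<forall>x\<in>{u<..<c}. g x = (h ^^ a) x) \<and> (\<forall>x\<in>{c<..<v}. g x = (h ^^ b) x) \<and>
     ((h ^^ a) \<longlongrightarrow> g u) (at_right u) \<and> ((h ^^ b) \<longlongrightarrow> g v) (at_left v)"

definition Orb :: "(real \<Rightarrow> real) \<Rightarrow> real \<Rightarrow> real set" where
  "Orb f x = range (\<lambda>k. (f ^^ k) x)"

definition J_set :: "(real \<Rightarrow> real) \<Rightarrow> real \<Rightarrow> real \<Rightarrow> real set" where
  "J_set f u v = {x \<in> {0..1}. Orb f x \<inter> {u<..<v} = {}}"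

definition contains_periodic_orbit :: "(real \<Rightarrow> real) \<Rightarrow> real set \<Rightarrow> bool" where
  "contains_periodic_orbit f A \<longleftrightarrow> (\<exists>x\<in>{0..1}. (\<exists>p\<ge>1. (f ^^ p) x = x) \<and> Orb f x \<subseteq> A)"

definition hit_time :: "(real \<Rightarrow> real) \<Rightarrow> real \<Rightarrow> real set \<Rightarrow> nat" where
  "hit_time f c U = (LEAST n. \<exists>z\<in>U. (f ^^ n) z = c)"

(* Maps on an interval [u, v] with critical point c are compared as partial functions with domain
   [u, v] - {c}, so that equality means equal intervals and equal values; the value at c is left
   out because it is a matter of convention. *)
definition interval_map :: "real \<Rightarrow> real \<Rightarrow> real \<Rightarrow> (real \<Rightarrow> real) \<Rightarrow> (real \<rightharpoonup> real)" where
  "interval_map u v c g = (\<lambda>x. Some (g x)) |` ({u..v} - {c})"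

(* R_E f on its domain [f^r(c+), f^l(c-)]. As in lorenz_pair, the values at the two endpoints
   are one-sided limits. *)
definition R_map :: "(real \<Rightarrow> real) \<Rightarrow> real \<Rightarrow> real set \<Rightarrow> (real \<rightharpoonup> real)" where
  "R_map f c E =
     (let e_minus = Sup {x \<in> E. x < c};
          e_plus = Inf {x \<in> E. c < x};
          l = hit_time f c {e_minus<..<c};
          r = hit_time f c {c<..<e_plus};
          a = Lim (at_right c) (f ^^ r);
          b = Lim (at_left c) (f ^^ l)
      in interval_map a b c
           (\<lambda>x. if x < c then (if x = a then Lim (at_right a) (f ^^ l) else (f ^^ l) x)
                else (if x = b then Lim (at_left b) (f ^^ r) else (f ^^ r) x)))"

end

theory Submission
  imports Defs
begin

text \<open>
  A step \<open>(h, h\<^sup>2)\<close> or \<open>(h\<^sup>2, h)\<close> adds one of the two iteration times to the other, and \<open>h\<close> moves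
  every point of the open interval that falls outside \<open>[u, v]\<close> into \<open>(u, v)\<close>; so such a step keeps the
  set \<open>J\<close>, makes the times different and changes the map. A step \<open>(h\<^sup>2, h\<^sup>2)\<close> makes both times equal
  to \<open>m = l + r\<close>. There expansion forces \<open>h u \<ge> v\<close> and \<open>h v \<le> u\<close>, hence \<open>h\<close> has a 2-cycle
  \<open>p \<le> u < v \<le> q\<close>. Its \<open>f\<close>-orbit avoids \<open>(u, v)\<close>, because \<open>f\<^sup>m\<close> moves every point of \<open>(u, v)\<close> other than
  \<open>c\<close> towards \<open>c\<close>. Conversely \<open>h\<^sup>2\<close> pushes every other point of \<open>(p, q)\<close> away from the cycle until it
  lands in \<open>(u, v)\<close>, so \<open>e\<^sub>- = p\<close> and \<open>e\<^sub>+ = q\<close>, and the first hitting times of \<open>c\<close> from \<open>(p, c)\<close> and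
  \<open>(c, q)\<close> are both \<open>m\<close>.
\<close>

section \<open>Lorenz maps as pairs of expanding branches\<close>

text \<open>The derivative bound is kept only as strict expansion of distances, a form that survives
  affine rescaling and the reflection x -> -x. Each branch is closed at its outer end and open at
  \<open>c\<close>, where the one-sided limits carry the information.\<close>

locale lorenz_branches =
  fixes u v c :: real and g :: "real \<Rightarrow> real"
  assumes crit: "u < c" "c < v"
    and maps_to: "\<And>x. u \<le> x \<Longrightarrow> x \<le> v \<Longrightarrow> u \<le> g x \<and> g x \<le> v"
    and cont_left: "continuous_on {u..<c} g"
    and cont_right: "continuous_on {c<..v} g"
    and expand_left: "\<And>x y. u \<le> x \<Longrightarrow> x < y \<Longrightarrow> y < c \<Longrightarrow> y - x < g y - g x"
    and expand_right: "\<And>x y. c < x \<Longrightarrow> x < y \<Longrightarrow> y \<le> v \<Longrightarrow> y - x < g y - g x"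
    and lim_left: "(g \<longlongrightarrow> v) (at_left c)"
    and lim_right: "(g \<longlongrightarrow> u) (at_right c)"

text \<open>Integrate the derivative: the strong form of the fundamental theorem of calculus
  tolerates finitely many exceptional points of a continuous function, and k > 1 makes the resulting
  bound strict.\<close>

lemma expansion_off_finite:
  fixes g :: "real \<Rightarrow> real"
  assumes "finite S" "x < y" "1 < k" "continuous_on {x..y} g"
    and D: "\<And>t. t \<in> {x<..<y} - S \<Longrightarrow> \<exists>D\<ge>k. (g has_real_derivative D) (at t)"
  shows "y - x < g y - g x"
proof -
  obtain D where D: "\<And>t. t \<in> {x<..<y} - S \<Longrightarrow> k \<le> D t \<and> (g has_real_derivative D t) (at t)"
    using D by metis
  \<comment> \<open>The value \<open>k\<close> off the good points makes the lower bound hold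
    everywhere and does not affect the integral.\<close>
  define d where "d = (\<lambda>t. if t \<in> {x<..<y} - S then D t else k)"
  have "(d has_integral (g y - g x)) {x..y}"
  proof (rule fundamental_theorem_of_calculus_interior_strong)
    show "(g has_vector_derivative d t) (at t)" if "t \<in> {x<..<y} - S" for t
      using D[OF that] that by (simp add: d_def has_real_derivative_iff_has_vector_derivative)
  qed (use assms in auto)
  moreover have "((\<lambda>_. k) has_integral (y - x) * k) {x..y}"
    using has_integral_const_real[of k x y] \<open>x < y\<close> by simp
  moreover have "k \<le> d t" for t
    using D[of t] by (cases "t \<in> {x<..<y} - S") (simp_all add: d_def)
  ultimately have "(y - x) * k \<le> g y - g x"
    using has_integral_le by blast
  moreover have "(y - x) * 1 < (y - x) * k"
    using assms by (intro mult_strict_left_mono) auto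
  ultimately show ?thesis by simp
qed

lemma expanding_lorenz_branches:
  assumes "expanding_lorenz g c"
  shows "lorenz_branches 0 1 c g"
proof -
  obtain S k where S: "finite S" "k > 1"
      "\<And>x. x \<in> {0..1} - S \<Longrightarrow> \<exists>D\<ge>k. (g has_real_derivative D) (at x within {0..1})"
    using assms unfolding expanding_lorenz_def by blast
  have cl: "continuous_on {0..<c} g" and cr: "continuous_on {c<..1} g" and c: "0 < c" "c < 1"
      and lims: "(g \<longlongrightarrow> 1) (at_left c)" "(g \<longlongrightarrow> 0) (at_right c)"
      and maps: "g ` {0..1} \<subseteq> {0..1}"
    using assms unfolding expanding_lorenz_def by blast+
  have D: "\<exists>D\<ge>k. (g has_real_derivative D) (at t)"
    if "t \<in> {x<..<y} - S" "0 \<le> x" "y \<le> 1" for t x y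
  proof -
    have "at t within {0..1} = at t"
      using that by (intro at_within_Icc_at) auto
    then show ?thesis using S(3)[of t] that by auto
  qed
  show ?thesis
  proof
    show "y - x < g y - g x" if "0 \<le> x" "x < y" "y < c" for x y
      by (rule expansion_off_finite[OF S(1) that(2) S(2) continuous_on_subset[OF cl] D])
         (use that c in auto)
    show "y - x < g y - g x" if "c < x" "x < y" "y \<le> 1" for x y
      by (rule expansion_off_finite[OF S(1) that(2) S(2) continuous_on_subset[OF cr] D])
         (use that c in auto)
  qed (use cl cr c lims maps in \<open>auto simp: image_subset_iff\<close>)
qed

text \<open>The affine substitution multiplies both sides of the expansion inequality by the same
  factor \<open>s\<close>, so every property is transported from the conjugate map
  \<open>\<phi>\<close> on [0,1].\<close>

lemma lorenz_on_branches:
  assumes "lorenz_on u v g c"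
  shows "lorenz_branches u v c g"
proof -
  define s where "s = v - u"
  define \<phi> where "\<phi> = (\<lambda>t. (g (u + s * t) - u) / s)"
  have s: "0 < s" and v: "v = u + s"
    using assms by (auto simp: s_def lorenz_on_def)
  have "lorenz_branches 0 1 ((c - u) / s) \<phi>"
    using assms unfolding lorenz_on_def \<phi>_def s_def by (intro expanding_lorenz_branches) simp
  then interpret \<phi>: lorenz_branches 0 1 "(c - u) / s" \<phi> .
  have g: "g = (\<lambda>x. u + s * \<phi> ((x - u) / s))"
    using s by (auto simp: \<phi>_def)
  have lim: "((\<lambda>x. (x - u) / s) \<longlongrightarrow> (c - u) / s) (at c within A)" for A
    by (intro tendsto_intros) (use s in auto)
  show ?thesis
  proof
    show "u < c" "c < v"
      using \<phi>.crit s by (auto simp: v field_simps)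
    show "u \<le> g x \<and> g x \<le> v" if "u \<le> x" "x \<le> v" for x
    proof -
      have "0 \<le> \<phi> ((x - u) / s) \<and> \<phi> ((x - u) / s) \<le> 1"
        using that s by (intro \<phi>.maps_to) (auto simp: v field_simps)
      then show ?thesis using s by (auto simp: g v)
    qed
    show "continuous_on {u..<c} g"
      unfolding g
      by (intro continuous_intros continuous_on_compose2[OF \<phi>.cont_left])
         (use s in \<open>auto simp: divide_strict_right_mono\<close>)
    show "continuous_on {c<..v} g"
      unfolding g
      by (intro continuous_intros continuous_on_compose2[OF \<phi>.cont_right])
         (use s in \<open>auto simp: v divide_strict_right_mono\<close>)
    show "y - x < g y - g x" if "u \<le> x" "x < y" "y < c" for x y
    proof -
      have "(y - u) / s - (x - u) / s < \<phi> ((y - u) / s) - \<phi> ((x - u) / s)"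
        using that s by (intro \<phi>.expand_left) (auto simp: divide_strict_right_mono)
      then show ?thesis using s by (simp add: g field_simps)
    qed
    show "y - x < g y - g x" if "c < x" "x < y" "y \<le> v" for x y
    proof -
      have "(y - u) / s - (x - u) / s < \<phi> ((y - u) / s) - \<phi> ((x - u) / s)"
        using that s by (intro \<phi>.expand_right) (auto simp: v divide_strict_right_mono)
      then show ?thesis using s by (simp add: g field_simps)
    qed
    have "filterlim (\<lambda>x. (x - u) / s) (at_left ((c - u) / s)) (at_left c)"
      unfolding filterlim_at using s
      by (intro conjI lim) (auto simp: eventually_at_filter divide_strict_right_mono)
    then have "(g \<longlongrightarrow> u + s * 1) (at_left c)"
      unfolding g by (intro tendsto_intros filterlim_compose[OF \<phi>.lim_left])
    then show "(g \<longlongrightarrow> v) (at_left c)" by (simp add: v)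
    have "filterlim (\<lambda>x. (x - u) / s) (at_right ((c - u) / s)) (at_right c)"
      unfolding filterlim_at using s
      by (intro conjI lim) (auto simp: eventually_at_filter divide_strict_right_mono)
    then have "(g \<longlongrightarrow> u + s * 0) (at_right c)"
      unfolding g by (intro tendsto_intros filterlim_compose[OF \<phi>.lim_right])
    then show "(g \<longlongrightarrow> u) (at_right c)" by simp
  qed
qed

context lorenz_branches
begin

lemma mono_left: "u \<le> x \<Longrightarrow> x < y \<Longrightarrow> y < c \<Longrightarrow> g x < g y"
  using expand_left[of x y] by simp

lemma mono_right: "c < x \<Longrightarrow> x < y \<Longrightarrow> y \<le> v \<Longrightarrow> g x < g y"
  using expand_right[of x y] by simp

text \<open>By expansion the displacement g x - x increases along the branch, and at
  \<open>u\<close> it is at least 0. The mirror argument from \<open>v\<close> gives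
  \<open>right_down\<close>.\<close>

lemma left_up: "u < x \<Longrightarrow> x < c \<Longrightarrow> x < g x"
  using expand_left[of u x] maps_to[of u] crit by simp

lemma right_down: "c < x \<Longrightarrow> x < v \<Longrightarrow> g x < x"
  using expand_right[of x v] maps_to[of v] crit by simp

lemma left_less: "u \<le> x \<Longrightarrow> x < c \<Longrightarrow> g x < v"
  using mono_left[of x "(x + c) / 2"] maps_to[of "(x + c) / 2"] crit by simp

lemma right_greater: "c < x \<Longrightarrow> x \<le> v \<Longrightarrow> u < g x"
  using mono_right[of "(x + c) / 2" x] maps_to[of "(x + c) / 2"] crit by simp

lemma isCont_left: "u < x \<Longrightarrow> x < c \<Longrightarrow> isCont g x"
  using cont_left by (rule continuous_on_interior) simp

lemma lim_at_right_of:
  assumes "u \<le> x" "x < c"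
  shows "(g \<longlongrightarrow> g x) (at_right x)"
proof -
  have "(g \<longlongrightarrow> g x) (at x within {x..<c})"
    using continuous_on_subset[OF cont_left, of "{x..<c}"] assms by (auto simp: continuous_on_def)
  moreover have "at x within {x..<c} = at_right x"
    using assms by (intro at_within_nhd[of _ "{..<c}"]) auto
  ultimately show ?thesis by simp
qed

text \<open>The reflection x -> -x exchanges the two branches, so facts about the right branch
  follow from those about the left one.\<close>

lemma reflect: "lorenz_branches (- v) (- u) (- c) (\<lambda>x. - g (- x))"
proof
  show "- v \<le> - g (- x) \<and> - g (- x) \<le> - u" if "- v \<le> x" "x \<le> - u" for x
    using maps_to[of "- x"] that by auto
  show "continuous_on {- v..<- c} (\<lambda>x. - g (- x))" 
    by (intro continuous_intros continuous_on_compose2[OF cont_right]) auto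
  show "continuous_on {- c<..- u} (\<lambda>x. - g (- x))"
    by (intro continuous_intros continuous_on_compose2[OF cont_left]) auto
  show "y - x < - g (- y) - - g (- x)" if "- v \<le> x" "x < y" "y < - c" for x y
    using expand_right[of "- y" "- x"] that by simp
  show "y - x < - g (- y) - - g (- x)" if "- c < x" "x < y" "y \<le> - u" for x y
    using expand_left[of "- y" "- x"] that by simp
  have "((\<lambda>x. - g x) \<longlongrightarrow> - u) (at_right c)"
    by (intro tendsto_minus lim_right)
  then show "((\<lambda>x. - g (- x)) \<longlongrightarrow> - u) (at_left (- c))"
    by (simp add: filterlim_at_left_to_right)
  have "((\<lambda>x. - g x) \<longlongrightarrow> - v) (at_left c)"
    by (intro tendsto_minus lim_left)
  then show "((\<lambda>x. - g (- x)) \<longlongrightarrow> - v) (at_right (- c))"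
    by (simp add: filterlim_at_left_to_right)
qed (use crit in auto)

lemma lim_at_left_of:
  assumes "c < x" "x \<le> v"
  shows "(g \<longlongrightarrow> g x) (at_left x)"
proof -
  have "((\<lambda>y. - g (- y)) \<longlongrightarrow> - g x) (at_right (- x))"
    using lorenz_branches.lim_at_right_of[OF reflect, of "- x"] assms by simp
  then have "((\<lambda>y. - g y) \<longlongrightarrow> - g x) (at_left x)"
    by (simp add: filterlim_at_left_to_right)
  then show ?thesis by (simp add: tendsto_minus_cancel_left)
qed

text \<open>The branch only tends to \<open>v\<close> at \<open>c\<close>, so the intermediate value
  theorem is applied up to a point \<open>y\<close> close enough to \<open>c\<close> that its image
  exceeds \<open>t\<close>.\<close>

lemma ivt_left:
  assumes "u \<le> x" "x < c" "g x < t" "t < v"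
  obtains z where "x < z" "z < c" "g z = t"
proof -
  have "\<forall>\<^sub>F y in at_left c. t < g y" using order_tendstoD(1)[OF lim_left assms(4)] .
  moreover have "\<forall>\<^sub>F y in at_left c. y \<in> {x<..<c}"
    using assms by (intro eventually_at_left_real)
  ultimately obtain y where y: "t < g y" "x < y" "y < c"
    using eventually_happens[OF eventually_conj] trivial_limit_at_left_real by force
  have "continuous_on {x..y} g"
    using y assms by (intro continuous_on_subset[OF cont_left]) auto
  then obtain z where "x \<le> z" "z \<le> y" "g z = t"
    using IVT'[of g x t y] y assms by auto
  with y assms that[of z] show thesis by (cases "z = x") auto
qed

text \<open>Approach strictly from below is what permits composition with a function whose limit at
  \<open>v\<close> is known only from the left.\<close>

lemma lim_left_at_left: "filterlim g (at_left v) (at_left c)"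
  unfolding filterlim_at
proof (intro conjI lim_left)
  have "\<forall>\<^sub>F y in at_left c. y \<in> {u<..<c}"
    using crit by (intro eventually_at_left_real)
  then show "\<forall>\<^sub>F x in at_left c. g x \<in> {..<v} \<and> g x \<noteq> v"
    by eventually_elim (use left_less in \<open>metis greaterThanLessThan_iff lessThan_iff less_le\<close>)
qed

end

section \<open>Endpoint relations forced by a renormalization\<close>

lemma renormalize_left_one:
  assumes "lorenz_branches u' v' c h" "lorenz_branches u v c g" "u' \<le> u"
    and eq: "\<And>x. u < x \<Longrightarrow> x < c \<Longrightarrow> g x = h x"
  shows "v = v'"
proof -
  interpret h: lorenz_branches u' v' c h by fact
  interpret g: lorenz_branches u v c g by fact
  have "\<forall>\<^sub>F x in at_left c. x \<in> {u<..<c}"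
    using g.crit by (intro eventually_at_left_real)
  then have "\<forall>\<^sub>F x in at_left c. h x = g x"
    by eventually_elim (use eq in auto)
  then have "(g \<longlongrightarrow> v') (at_left c)"
    using h.lim_left by (rule Lim_transform_eventually[rotated])
  then show ?thesis
    using tendsto_unique[OF _ g.lim_left] trivial_limit_at_left_real by blast
qed

text \<open>The first claim compares left limits at \<open>c\<close>. For the second, if h u < c
  then \<open>h\<close> crosses \<open>c\<close> at some \<open>z\<close> in (u, c); there h o h
  jumps from v' on the left to u' on the right, whereas \<open>g\<close> is continuous at
  \<open>z\<close>.\<close>

lemma renormalize_left_two:
  assumes "lorenz_branches u' v' c h" "lorenz_branches u v c g" "u' \<le> u"
    and eq: "\<And>x. u < x \<Longrightarrow> x < c \<Longrightarrow> g x = h (h x)"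
  shows "v = h v'" "c \<le> h u"
proof -
  interpret h: lorenz_branches u' v' c h by fact
  interpret g: lorenz_branches u v c g by fact
  have "\<forall>\<^sub>F x in at_left c. x \<in> {u<..<c}"
    using g.crit by (intro eventually_at_left_real)
  then have "\<forall>\<^sub>F x in at_left c. h (h x) = g x"
    by eventually_elim (use eq in auto)
  moreover have "((\<lambda>x. h (h x)) \<longlongrightarrow> h v') (at_left c)"
    using h.lim_at_left_of[OF h.crit(2) order_refl] h.lim_left_at_left by (rule filterlim_compose)
  ultimately have "(g \<longlongrightarrow> h v') (at_left c)"
    by (rule Lim_transform_eventually[rotated])
  then show "v = h v'"
    using tendsto_unique[OF _ g.lim_left] trivial_limit_at_left_real by blast
  show "c \<le> h u"
  proof (rule ccontr)
    assume "\<not> c \<le> h u"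
    then obtain z where z: "u < z" "z < c" "h z = c"
      using h.ivt_left[of u c] g.crit h.crit assms(3) by auto
    have hz: "(h \<longlongrightarrow> c) (at z within A)" for A
      using h.isCont_left[of z] z assms(3) by (auto simp: isCont_def intro: tendsto_within_subset)
    have gz: "(g \<longlongrightarrow> g z) (at z within A)" for A
      using g.isCont_left[of z] z by (auto simp: isCont_def intro: tendsto_within_subset)
    have L: "\<forall>\<^sub>F x in at_left z. x \<in> {u<..<z}"
      using z by (intro eventually_at_left_real)
    then have "filterlim h (at_left c) (at_left z)"
      unfolding filterlim_at using z assms(3)
      by (intro conjI hz) (auto elim!: eventually_mono dest: h.mono_left[of _ z, rotated])
    then have "((\<lambda>x. h (h x)) \<longlongrightarrow> v') (at_left z)"
      by (rule filterlim_compose[OF h.lim_left])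
    moreover have "\<forall>\<^sub>F x in at_left z. h (h x) = g x"
      using L by eventually_elim (use eq z in auto)
    ultimately have "(g \<longlongrightarrow> v') (at_left z)" by (rule Lim_transform_eventually)
    then have "g z = v'"
      using tendsto_unique[OF _ gz] trivial_limit_at_left_real by blast
    have R: "\<forall>\<^sub>F x in at_right z. x \<in> {z<..<c}"
      using z by (intro eventually_at_right_real)
    then have "filterlim h (at_right c) (at_right z)"
      unfolding filterlim_at using z assms(3)
      by (intro conjI hz) (auto elim!: eventually_mono dest: h.mono_left[of z, rotated])
    then have "((\<lambda>x. h (h x)) \<longlongrightarrow> u') (at_right z)"
      by (rule filterlim_compose[OF h.lim_right])
    moreover have "\<forall>\<^sub>F x in at_right z. h (h x) = g x"
      using R by eventually_elim (use eq z in auto)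
    ultimately have "(g \<longlongrightarrow> u') (at_right z)" by (rule Lim_transform_eventually)
    then have "g z = u'"
      using tendsto_unique[OF _ gz] trivial_limit_at_right_real by blast
    with \<open>g z = v'\<close> h.crit show False by simp
  qed
qed

lemma renormalize_right_one:
  assumes "lorenz_branches u' v' c h" "lorenz_branches u v c g" "v \<le> v'"
    and eq: "\<And>x. c < x \<Longrightarrow> x < v \<Longrightarrow> g x = h x"
  shows "u = u'"
  using renormalize_left_one[OF assms(1,2)[THEN lorenz_branches.reflect]] assms(3) eq by simp

lemma renormalize_right_two:
  assumes "lorenz_branches u' v' c h" "lorenz_branches u v c g" "v \<le> v'"
    and eq: "\<And>x. c < x \<Longrightarrow> x < v \<Longrightarrow> g x = h (h x)"
  shows "u = h u'" "h v \<le> c"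
  using renormalize_left_two[OF assms(1,2)[THEN lorenz_branches.reflect]] assms(3) eq by simp_all

section \<open>The step (h^2, h^2) and its 2-cycle\<close>

locale double_renormalization =
  h: lorenz_branches u' v' c h + g: lorenz_branches u v c g
  for u' v' u v c :: real and h g :: "real \<Rightarrow> real" +
  assumes sub: "u' \<le> u" "v \<le> v'"
    and eq_left: "\<And>x. u < x \<Longrightarrow> x < c \<Longrightarrow> g x = h (h x)"
    and eq_right: "\<And>x. c < x \<Longrightarrow> x < v \<Longrightarrow> g x = h (h x)"
begin

lemma reflect:
  "double_renormalization (- v') (- u') (- v) (- u) (- c) (\<lambda>x. - h (- x)) (\<lambda>x. - g (- x))"
  by (intro double_renormalization.intro h.reflect g.reflect double_renormalization_axioms.intro)
     (use sub eq_left eq_right in auto)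

lemma endpoints: "v = h v'" "u = h u'" "c \<le> h u" "h v \<le> c"
  using renormalize_left_two[OF h.lorenz_branches_axioms g.lorenz_branches_axioms sub(1) eq_left]
    renormalize_right_two[OF h.lorenz_branches_axioms g.lorenz_branches_axioms sub(2) eq_right]
  by auto

text \<open>Otherwise take \<open>z\<close> between h u and v, and \<open>x\<close> in (u, c) with h
  x = z. Then g x = h z < h v \<le> c, so x < g x < c, and applying \<open>h\<close> gives z < h (g
  x) = g z. This contradicts the fact that \<open>g\<close> moves points of its right branch
  down.\<close>

lemma v_le_h_u: "v \<le> h u"
proof (rule ccontr)
  assume less: "\<not> v \<le> h u"
  define z where "z = (h u + v) / 2"
  have z: "c < z" "z < v" "h u < z"
    using less endpoints(3) g.crit by (auto simp: z_def)
  then obtain x where x: "u < x" "x < c" "h x = z"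
    using h.ivt_left[of u z] sub g.crit by auto
  have "h z < h v"
    using h.mono_right[of z v] z sub by simp
  then have "g x < c"
    using endpoints(4) eq_left[OF x(1,2)] x(3) by simp
  then have "h x < h (g x)"
    using h.mono_left[of x "g x"] g.left_up[of x] x sub by simp
  then have "z < g z"
    using eq_left[OF x(1,2)] eq_right[OF z(1,2)] x(3) by simp
  then show False
    using g.right_down[OF z(1,2)] by simp
qed

text \<open>Pass to the limit in g x < x as \<open>x\<close> tends to \<open>v\<close> from the
  left. The mirror image of \<open>v_le_h_u\<close> puts h v in the interior of the left branch,
  where \<open>h\<close> is continuous.\<close>

lemma h_h_v_le: "h (h v) \<le> v"
proof -
  have "h v \<le> u"
    using double_renormalization.v_le_h_u[OF reflect] by simp
  then have "isCont h (h v)"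
    using h.right_greater[of v] sub g.crit by (intro h.isCont_left) auto
  then have "((\<lambda>x. h (h x)) \<longlongrightarrow> h (h v)) (at_left v)"
    using h.lim_at_left_of[of v] g.crit sub by (intro isCont_tendsto_compose[of "h v" h]) auto
  moreover have "\<forall>\<^sub>F x in at_left v. x \<in> {c<..<v}"
    using g.crit by (intro eventually_at_left_real)
  then have "\<forall>\<^sub>F x in at_left v. h (h x) \<le> v"
    by eventually_elim (metis eq_right g.right_down greaterThanLessThan_iff less_le_trans less_imp_le)
  ultimately show ?thesis
    by (rule tendsto_upperbound) simp
qed

text \<open>Choose \<open>a\<close> in [u', u] with h a = v. On [a, u] the image of \<open>h\<close>
  stays in the right branch, so h o h is continuous there; it moves \<open>a\<close> weakly down and
  \<open>u\<close> weakly up, hence has a fixed point between them.\<close>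

lemma obtain_cycle:
  obtains p where "u' < p" "p \<le> u" "v \<le> h p" "h p < v'" "h (h p) = p"
proof -
  have uc: "u < c" and cv: "c < v" using g.crit by auto
  have hv: "h v \<le> u"
    using double_renormalization.v_le_h_u[OF reflect] by simp
  have hhu: "u \<le> h (h u)"
    using double_renormalization.h_h_v_le[OF reflect] by simp
  have "continuous_on {u'..u} h"
    using uc by (intro continuous_on_subset[OF h.cont_left]) auto
  then obtain a where a: "u' \<le> a" "a \<le> u" "h a = v"
    using IVT'[of h u' v u] v_le_h_u endpoints(2) sub uc cv by auto
  have ge: "v \<le> h x" if "a \<le> x" "x \<le> u" for x
    using h.mono_left[of a x] that a uc by (cases "a = x") auto
  have "h v \<le> a"
  proof (rule ccontr)
    assume "\<not> h v \<le> a"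
    then have "h a < h (h v)" using a hv uc by (intro h.mono_left) auto
    then show False using h_h_v_le a by simp
  qed
  moreover have "continuous_on {a..u} (\<lambda>x. h (h x))"
  proof (rule continuous_on_compose2[OF h.cont_right])
    show "continuous_on {a..u} h"
      using uc a by (intro continuous_on_subset[OF h.cont_left]) auto
    show "h ` {a..u} \<subseteq> {c<..v'}"
      using ge cv a uc sub h.crit h.maps_to by force
  qed
  then have "continuous_on {a..u} (\<lambda>x. h (h x) - x)"
    by (intro continuous_intros)
  ultimately obtain p where p: "a \<le> p" "p \<le> u" "h (h p) = p"
    using IVT'[of "\<lambda>x. h (h x) - x" a 0 u] a hhu by auto
  have "v \<le> h p" using ge p by simp
  moreover have "u' < p"
    using \<open>v \<le> h p\<close> endpoints(2) uc cv a p by (cases "u' = p") auto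
  moreover have "h p < v'"
    using h.left_less[of p] a p uc by simp
  ultimately show thesis using that p by blast
qed

text \<open>The cycle repels under \<open>h \<circ> h\<close>, and the points it repels cannot jump over the hole.\<close>

lemma cycle_isolated_left:
  assumes cycle: "u' < p" "p \<le> u" "v \<le> q" "q < v'" "h p = q" "h q = p"
    and inv: "\<And>x. x \<in> A \<Longrightarrow> p < x \<Longrightarrow> x < c \<Longrightarrow> h (h x) \<in> A"
    and hole: "A \<inter> {u<..<v} = {}"
    and x0: "x0 \<in> A" "p < x0" "x0 < c"
  shows False
proof -
  have uc: "u < c" and cv: "c < v" using g.crit by auto
  \<comment> \<open>Between \<open>p\<close> and \<open>c\<close> the first application of
    \<open>h\<close> lands in [q, v'), so h o h uses one expanding branch after the other.\<close>
  have grow: "y - x < h (h y) - h (h x)" if "p \<le> x" "x < y" "y < c" for x y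
  proof -
    have "q \<le> h x"
      using h.mono_left[of p x] that cycle by (cases "p = x") auto
    then have "h y - h x < h (h y) - h (h x)"
      using h.maps_to[of y] h.mono_left[of x y] that cycle cv h.crit by (intro h.expand_right) auto
    moreover have "y - x < h y - h x"
      using that cycle by (intro h.expand_left) auto
    ultimately show ?thesis by simp
  qed
  \<comment> \<open>By \<open>grow\<close> the displacement of h o h vanishes at \<open>p\<close>
    and increases to its right, so its value at \<open>x0\<close> is a positive lower bound for all
    later points.\<close>
  define \<delta> where "\<delta> = h (h x0) - x0"
  have "0 < \<delta>"
    using grow[of p x0] x0 cycle by (simp add: \<delta>_def)
  define B where "B = {x \<in> A. x0 \<le> x \<and> x \<le> u}"
  \<comment> \<open>Points up to \<open>u\<close> are sent below h (h u) or onto it, hence below h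
    v' = v; being in \<open>A\<close>, the image avoids the hole and so is again at most
    \<open>u\<close>.\<close>
  have step: "h (h x) \<in> B \<and> x + \<delta> \<le> h (h x)" if "x \<in> B" for x
  proof -
    have x: "x \<in> A" "x0 \<le> x" "x \<le> u" using that by (auto simp: B_def)
    have "h (h x) \<le> h (h u)"
      using grow[of x u] x x0 uc by (cases "x = u") auto
    also have "\<dots> < h v'"
      using h.left_less[of u] v_le_h_u sub uc cv by (intro h.mono_right) auto
    finally have "h (h x) < v" using endpoints(1) by simp
    moreover have le: "x + \<delta> \<le> h (h x)"
      using grow[of x0 x] x x0 uc by (cases "x0 = x") (auto simp: \<delta>_def)
    moreover have "h (h x) \<in> A"
      using inv[of x] x x0 uc by simp
    ultimately show ?thesis
      using hole x \<open>0 < \<delta>\<close> by (force simp: B_def)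
  qed
  have "x0 \<in> B"
    using x0 hole cv by (force simp: B_def)
  moreover have bdd: "bdd_above B"
    by (rule bdd_aboveI[of _ u]) (simp add: B_def)
  \<comment> \<open>A point of \<open>B\<close> this close to the supremum is moved beyond it by one
    more application of h o h.\<close>
  ultimately obtain x where x: "x \<in> B" "Sup B - \<delta> < x"
    using less_cSup_iff[of B "Sup B - \<delta>"] \<open>0 < \<delta>\<close> by auto
  then have "h (h x) \<le> Sup B"
    using step bdd by (intro cSup_upper) auto
  then show False using step[OF x(1)] x(2) by simp
qed

lemma cycle_isolated_right:
  assumes cycle: "u' < p" "p \<le> u" "v \<le> q" "q < v'" "h p = q" "h q = p"
    and inv: "\<And>x. x \<in> A \<Longrightarrow> c < x \<Longrightarrow> x < q \<Longrightarrow> h (h x) \<in> A"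
    and hole: "A \<inter> {u<..<v} = {}"
    and x0: "x0 \<in> A" "c < x0" "x0 < q"
  shows False
proof (rule double_renormalization.cycle_isolated_left[OF reflect, of "- q" "- p" "uminus ` A" "- x0"])
  show "- h (- (- h (- x))) \<in> uminus ` A" if "x \<in> uminus ` A" "- q < x" "x < - c" for x
    using inv[of "- x"] that by auto
  show "uminus ` A \<inter> {- v<..<- u} = {}"
    using hole by auto
qed (use cycle x0 in auto)

text \<open>Since h q = p < c < v = h v', some \<open>w\<close> in (q, v') is mapped to
  \<open>c\<close>; it is then pulled back along the left branch, which takes \<open>p\<close> to q
  < w and tends to v' at \<open>c\<close>.\<close>

lemma hit_left:
  assumes cycle: "u' < p" "p \<le> u" "v \<le> q" "q < v'" "h p = q" "h q = p"
  obtains z where "p < z" "z < c" "h (h z) = c"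
proof -
  have uc: "u < c" and cv: "c < v" using g.crit by auto
  have "continuous_on {q..v'} h"
    using cycle cv by (intro continuous_on_subset[OF h.cont_right]) auto
  then obtain w where w: "q \<le> w" "w \<le> v'" "h w = c"
    using IVT'[of h q c v'] cycle uc cv endpoints(1) by auto
  have "q < w" "w < v'"
    using w cycle uc cv endpoints(1) by (auto simp: less_le)
  then obtain z where "p < z" "z < c" "h z = w"
    using h.ivt_left[of p w thesis] cycle(1,2,5) uc by fastforce
  then show thesis using that w(3) by simp
qed

lemma hit_right:
  assumes cycle: "u' < p" "p \<le> u" "v \<le> q" "q < v'" "h p = q" "h q = p"
  obtains z where "c < z" "z < q" "h (h z) = c"
proof -
  obtain z where "- q < z" "z < - c" "- h (- (- h (- z))) = - c"
    using double_renormalization.hit_left[OF reflect, of "- q" "- p"] cycle by auto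
  then show thesis using that[of "- z"] by auto
qed

end

section \<open>Iteration times, the set J and the map R_J f for a double step\<close>

text \<open>The second conjunct keeps track of the time at which an orbit first meets the critical point:
  continuity of an iterate at a point does not by itself exclude an earlier visit to \<open>c\<close>.\<close>

definition reaches :: "(real \<Rightarrow> real) \<Rightarrow> real \<Rightarrow> nat \<Rightarrow> real \<Rightarrow> real \<Rightarrow> bool" where
  "reaches f c k x y \<longleftrightarrow> y = (f ^^ k) x \<and> (\<forall>j<k. (f ^^ j) x \<noteq> c)"

lemma reaches_trans:
  assumes "reaches f c k x y" "reaches f c m y z"
  shows "reaches f c (k + m) x z"
proof -
  have "(f ^^ j) x \<noteq> c" if "j < k + m" for j
  proof (cases "j < k")
    case False
    then have "(f ^^ j) x = (f ^^ (j - k)) y"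
      using assms(1) funpow_add[of "j - k" k f] by (simp add: reaches_def)
    then show ?thesis using assms(2) that False by (simp add: reaches_def)
  qed (use assms in \<open>auto simp: reaches_def\<close>)
  then show ?thesis
    using assms by (simp add: reaches_def add.commute[of k m] funpow_add)
qed

text \<open>Only interior points are constrained, because the orbit of an endpoint may meet
  \<open>c\<close> too early.\<close>

definition branch_times ::
  "(real \<Rightarrow> real) \<Rightarrow> real \<Rightarrow> nat \<Rightarrow> nat \<Rightarrow> real \<Rightarrow> real \<Rightarrow> (real \<Rightarrow> real) \<Rightarrow> bool" where
  "branch_times f c l r u v g \<longleftrightarrow>
     (\<forall>x\<in>{u<..<c}. reaches f c l x (g x)) \<and> (\<forall>x\<in>{c<..<v}. reaches f c r x (g x))"

text \<open>These are the one-sided limits by which \<open>lorenz_pair\<close> and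
  \<open>R_map\<close> prescribe endpoints and endpoint values.\<close>

lemma branch_times_limits:
  assumes "lorenz_branches u v c g" "branch_times f c l r u v g"
  shows "((f ^^ l) \<longlongrightarrow> g u) (at_right u)" "((f ^^ r) \<longlongrightarrow> g v) (at_left v)"
    "((f ^^ l) \<longlongrightarrow> v) (at_left c)" "((f ^^ r) \<longlongrightarrow> u) (at_right c)"
proof -
  interpret g: lorenz_branches u v c g by fact
  have L: "\<And>x. x \<in> {u<..<c} \<Longrightarrow> g x = (f ^^ l) x" and R: "\<And>x. x \<in> {c<..<v} \<Longrightarrow> g x = (f ^^ r) x"
    using assms(2) by (auto simp: branch_times_def reaches_def)
  note ev = g.crit[THEN eventually_at_right_real] g.crit[THEN eventually_at_left_real]
  show "((f ^^ l) \<longlongrightarrow> g u) (at_right u)"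
    by (rule Lim_transform_eventually[OF g.lim_at_right_of eventually_mono[OF ev(1) L]])
       (use g.crit in auto)
  show "((f ^^ r) \<longlongrightarrow> g v) (at_left v)"
    by (rule Lim_transform_eventually[OF g.lim_at_left_of eventually_mono[OF ev(4) R]])
       (use g.crit in auto)
  show "((f ^^ l) \<longlongrightarrow> v) (at_left c)"
    by (rule Lim_transform_eventually[OF g.lim_left eventually_mono[OF ev(3) L]])
  show "((f ^^ r) \<longlongrightarrow> u) (at_right c)"
    by (rule Lim_transform_eventually[OF g.lim_right eventually_mono[OF ev(2) R]])
qed

lemma funpow_in_interval:
  fixes f :: "real \<Rightarrow> real"
  assumes "f ` {0..1} \<subseteq> {0..1}" "x \<in> {0..1}"
  shows "(f ^^ k) x \<in> {0..1}"
  using assms by (induction k) (auto simp: image_subset_iff)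

lemma Orb_funpow_subset: "Orb f ((f ^^ k) x) \<subseteq> Orb f x"
proof -
  have "(f ^^ j) ((f ^^ k) x) = (f ^^ (j + k)) x" for j by (simp add: funpow_add)
  then show ?thesis by (auto simp: Orb_def)
qed

lemma J_set_funpow:
  assumes "f ` {0..1} \<subseteq> {0..1}" "x \<in> J_set f u v"
  shows "(f ^^ k) x \<in> J_set f u v"
  using assms funpow_in_interval[OF assms(1), of x k] Orb_funpow_subset[of f k x]
  by (auto simp: J_set_def)

lemma J_set_hole: "J_set f u v \<inter> {u<..<v} = {}"
proof -
  have "x \<in> Orb f x" for x
    unfolding Orb_def by (rule range_eqI[of _ _ 0]) simp
  then show ?thesis by (auto simp: J_set_def)
qed

text \<open>As c \<le> h u and h v \<le> c, interior points change sides under \<open>h\<close>, so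
  both branches of \<open>g\<close> use each time of \<open>h\<close> exactly once.\<close>

lemma branch_times_double:
  assumes "double_renormalization u' v' u v c h g" "branch_times f c l r u' v' h"
  shows "branch_times f c (l + r) (l + r) u v g"
proof -
  interpret double_renormalization u' v' u v c h g by fact
  have "reaches f c (l + r) x (g x)" if x: "u < x" "x < c" for x
  proof (rule reaches_trans)
    show "reaches f c l x (h x)"
      using assms(2) x sub by (auto simp: branch_times_def)
    have "c < h x" "h x < v'"
      using h.mono_left[of u x] h.left_less[of x] endpoints(3) x sub by auto
    then show "reaches f c r (h x) (g x)"
      using assms(2) x by (auto simp: branch_times_def eq_left)
  qed
  moreover have "reaches f c (r + l) x (g x)" if x: "c < x" "x < v" for x
  proof (rule reaches_trans)
    show "reaches f c r x (h x)"
      using assms(2) x sub by (auto simp: branch_times_def)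
    have "h x < c" "u' < h x"
      using h.mono_right[of x v] h.right_greater[of x] endpoints(4) x sub by auto
    then show "reaches f c l (h x) (g x)"
      using assms(2) x by (auto simp: branch_times_def eq_right)
  qed
  ultimately show ?thesis by (auto simp: branch_times_def add.commute)
qed

text \<open>Besides settling the case where the last step is double, this is applied to the last
  double step when trivial ones follow it.\<close>

lemma double_renormalization_J_set:
  assumes "double_renormalization u' v' u v c h g" "branch_times f c l r u' v' h"
    and f: "f ` {0..1} \<subseteq> {0..1}" and l: "1 \<le> l" and bounds: "0 \<le> u'" "v' \<le> 1"
  shows "contains_periodic_orbit f (J_set f u v)"
    and "R_map f c (J_set f u v) = interval_map u v c g"
proof -
  interpret double_renormalization u' v' u v c h g by fact
  have uc: "u < c" and cv: "c < v" using g.crit by auto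
  define m where "m = l + r"
  define J where "J = J_set f u v"
  have bt: "branch_times f c m m u v g"
    unfolding m_def using assms(1,2) by (rule branch_times_double)
  have left: "reaches f c l x (h x)" if "u' < x" "x < c" for x
    using assms(2) that by (auto simp: branch_times_def)
  have right: "reaches f c r x (h x)" if "c < x" "x < v'" for x
    using assms(2) that by (auto simp: branch_times_def)
  obtain p where p: "u' < p" "p \<le> u" "v \<le> h p" "h p < v'" "h (h p) = p"
    by (rule obtain_cycle)
  define q where "q = h p"
  have cycle: "u' < p" "p \<le> u" "v \<le> q" "q < v'" "h p = q" "h q = p"
    using p by (auto simp: q_def)
  \<comment> \<open>The half-open range includes \<open>p\<close>, so this gives the periodicity of
    \<open>p\<close>; it also shows that no point of (p, c) meets \<open>c\<close> before time
    \<open>m\<close>.\<close>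
  have left2: "reaches f c m x (h (h x))" if "p \<le> x" "x < c" for x
    unfolding m_def
  proof (rule reaches_trans)
    show "reaches f c l x (h x)" using left that cycle by simp
    have "q \<le> h x"
      using h.mono_left[of p x] that cycle by (cases "p = x") auto
    then show "reaches f c r (h x) (h (h x))"
      using h.left_less[of x] that cycle cv by (intro right) auto
  qed
  have right2: "reaches f c m x (h (h x))" if "c < x" "x \<le> q" for x
    unfolding m_def add.commute[of l]
  proof (rule reaches_trans)
    show "reaches f c r x (h x)" using right that cycle by simp
    have "h x \<le> p"
      using h.mono_right[of x q] that cycle by (cases "x = q") auto
    then show "reaches f c l (h x) (h (h x))"
      using h.right_greater[of x] that cycle uc by (intro left) auto
  qed
  have per_p: "reaches f c m p p" and per_q: "reaches f c m q q"
    using left2[of p] right2[of q] cycle uc cv by auto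
  have m: "1 \<le> m" using l by (simp add: m_def)
  \<comment> \<open>If the orbit entered (u, v) at \<open>y\<close>, reducing the time modulo
    \<open>m\<close> would show that \<open>y\<close> differs from \<open>c\<close>. Then g y = f^m
    y = y, although \<open>g\<close> has no fixed point in (u, v) other than possibly
    \<open>c\<close>.\<close>
  have in_J: "Orb f x \<subseteq> J" if x: "x \<in> {0..1}" "reaches f c m x x" for x
  proof -
    have "(f ^^ k) x \<notin> {u<..<v}" for k
    proof
      define y where "y = (f ^^ k) x"
      assume "(f ^^ k) x \<in> {u<..<v}"
      then have y: "u < y" "y < v" by (auto simp: y_def)
      have "(f ^^ (k mod m)) x = y"
        using x(2) by (simp add: y_def reaches_def funpow_mod_eq)
      moreover have "k mod m < m" using m by simp
      ultimately have "y \<noteq> c" using x(2) by (auto simp: reaches_def)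
      then have "g y = (f ^^ m) y"
        using y bt by (cases y c rule: linorder_cases) (auto simp: branch_times_def reaches_def)
      also have "\<dots> = (f ^^ k) ((f ^^ m) x)"
        by (simp add: y_def flip: funpow_add comp_apply[of "f ^^ m"] comp_apply[of "f ^^ k"] add: add.commute)
      also have "\<dots> = y" using x(2) by (simp add: reaches_def y_def)
      finally show False
        using g.left_up[of y] g.right_down[of y] y \<open>y \<noteq> c\<close>
        by (cases y c rule: linorder_cases) auto
    qed
    then have "Orb f x \<inter> {u<..<v} = {}" by (auto simp: Orb_def)
    then have "x \<in> J" using x by (simp add: J_def J_set_def)
    then show ?thesis
      using J_set_funpow[OF f] by (auto simp: J_def Orb_def)
  qed
  have p01: "p \<in> {0..1}" and q01: "q \<in> {0..1}"
    using cycle bounds uc cv sub h.crit by auto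
  show "contains_periodic_orbit f (J_set f u v)"
    unfolding contains_periodic_orbit_def
    using p01 m per_p in_J[OF p01 per_p] by (intro bexI[of _ p]) (auto simp: J_def reaches_def)
  have "p \<in> J" "q \<in> J"
    using in_J[OF p01 per_p] in_J[OF q01 per_q] unfolding Orb_def
    by (metis funpow_0 rangeI subsetD)+
  have closed_left: "h (h x) \<in> J" if "x \<in> J" "p < x" "x < c" for x
    using left2[of x] J_set_funpow[OF f, of x u v m] that by (simp add: reaches_def J_def)
  have closed_right: "h (h x) \<in> J" if "x \<in> J" "c < x" "x < q" for x
    using right2[of x] J_set_funpow[OF f, of x u v m] that by (simp add: reaches_def J_def)
  have hole: "J \<inter> {u<..<v} = {}"
    unfolding J_def by (rule J_set_hole)
  have e_minus: "Sup {x \<in> J. x < c} = p"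
    by (rule cSup_eq_maximum)
       (use \<open>p \<in> J\<close> cycle(2) uc cycle_isolated_left[OF cycle closed_left hole] in \<open>auto simp: not_less[symmetric]\<close>)
  have e_plus: "Inf {x \<in> J. c < x} = q"
    by (rule cInf_eq_minimum)
       (use \<open>q \<in> J\<close> cycle(3) cv cycle_isolated_right[OF cycle closed_right hole] in \<open>auto simp: not_less[symmetric]\<close>)
  obtain z1 where z1: "p < z1" "z1 < c" "h (h z1) = c" using hit_left[OF cycle] .
  obtain z2 where z2: "c < z2" "z2 < q" "h (h z2) = c" using hit_right[OF cycle] .
  \<comment> \<open>The point \<open>z1\<close> shows that time \<open>m\<close> suffices, and
    \<open>left2\<close> excludes every smaller time.\<close>
  have hit_l: "hit_time f c {p<..<c} = m"
    unfolding hit_time_def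
  proof (rule Least_equality)
    show "\<exists>z\<in>{p<..<c}. (f ^^ m) z = c"
      using z1 left2[of z1] by (auto simp: reaches_def intro!: bexI[of _ z1])
    show "m \<le> k" if hit: "\<exists>z\<in>{p<..<c}. (f ^^ k) z = c" for k
    proof -
      obtain z where "z \<in> {p<..<c}" "(f ^^ k) z = c" using hit by blast
      then show ?thesis
        using left2[of z] by (auto simp: reaches_def not_less[symmetric])
    qed
  qed
  have hit_r: "hit_time f c {c<..<q} = m"
    unfolding hit_time_def
  proof (rule Least_equality)
    show "\<exists>z\<in>{c<..<q}. (f ^^ m) z = c"
      using z2 right2[of z2] by (auto simp: reaches_def intro!: bexI[of _ z2])
    show "m \<le> k" if hit: "\<exists>z\<in>{c<..<q}. (f ^^ k) z = c" for k
    proof -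
      obtain z where "z \<in> {c<..<q}" "(f ^^ k) z = c" using hit by blast
      then show ?thesis
        using right2[of z] by (auto simp: reaches_def not_less[symmetric])
    qed
  qed
  note lims = branch_times_limits[OF g.lorenz_branches_axioms bt]
  have Lims: "Lim (at_right u) (f ^^ m) = g u" "Lim (at_left v) (f ^^ m) = g v"
      "Lim (at_left c) (f ^^ m) = v" "Lim (at_right c) (f ^^ m) = u"
    using lims by (simp_all add: tendsto_Lim)
  have eq: "(if x < c then if x = u then g u else (f ^^ m) x
             else if x = v then g v else (f ^^ m) x) = g x" if "x \<in> {u..v} - {c}" for x
    using that bt by (auto simp: branch_times_def reaches_def less_le)
  show "R_map f c (J_set f u v) = interval_map u v c g"
    unfolding R_map_def Let_def J_def[symmetric] e_minus e_plus hit_l hit_r Lims interval_map_def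
    by (rule ext) (use eq in \<open>auto simp: restrict_map_def\<close>)
qed

section \<open>The steps (h, h^2) and (h^2, h)\<close>

locale trivial_renormalization =
  h: lorenz_branches u' v' c h + g: lorenz_branches u v c g
  for u' v' u v c :: real and h g :: "real \<Rightarrow> real" +
  assumes sub: "u' \<le> u" and v_eq: "v = v'"
    and u_eq: "u = h u'" and h_v_le: "h v \<le> c"
    and eq_left: "\<And>x. u < x \<Longrightarrow> x < c \<Longrightarrow> g x = h x"
    and eq_right: "\<And>x. c < x \<Longrightarrow> x < v \<Longrightarrow> g x = h (h x)"
begin

lemma h_right: "c < x \<Longrightarrow> x < v \<Longrightarrow> u' < h x \<and> h x < c"
  using h.mono_right[of x v] h.right_greater[of x] h_v_le v_eq by auto

lemma enters: "u' < x \<Longrightarrow> x \<le> u \<Longrightarrow> u < h x \<and> h x < v"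
  using h.mono_left[of u' x] h.left_less[of x] u_eq v_eq g.crit by auto

lemma gap_left: "u < x \<Longrightarrow> x < c \<Longrightarrow> v - g x = v' - h x"
  by (simp add: v_eq eq_left)

text \<open>Here g x - u = h (h x) - h u', and \<open>h\<close> expands the interval from u' to h x.
  The gaps serve to show that a trivial step changes the map even if it keeps the interval.\<close>

lemma gap_right: "c < x \<Longrightarrow> x < v \<Longrightarrow> h x - u' < g x - u"
  using h.expand_left[of u' "h x"] h_right[of x] by (simp add: eq_right u_eq)

end

lemma trivial_renormalizationI:
  assumes "lorenz_branches u' v' c h" "lorenz_branches u v c g" "u' \<le> u" "v \<le> v'"
    and eq_left: "\<And>x. u < x \<Longrightarrow> x < c \<Longrightarrow> g x = h x"
    and eq_right: "\<And>x. c < x \<Longrightarrow> x < v \<Longrightarrow> g x = h (h x)"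
  shows "trivial_renormalization u' v' u v c h g"
  using renormalize_left_one[OF assms(1-3) eq_left]
    renormalize_right_two[OF assms(1,2,4) eq_right] assms
  by (intro trivial_renormalization.intro trivial_renormalization_axioms.intro) auto

text \<open>A renormalization \<open>(h\<^sup>2, h)\<close> is handled as the mirror image of a renormalization \<open>(h, h\<^sup>2)\<close>.\<close>

definition trivial_step ::
  "real \<Rightarrow> real \<Rightarrow> real \<Rightarrow> real \<Rightarrow> real \<Rightarrow> (real \<Rightarrow> real) \<Rightarrow> (real \<Rightarrow> real) \<Rightarrow> bool" where
  "trivial_step u' v' u v c h g \<longleftrightarrow>
     trivial_renormalization u' v' u v c h g \<or>
     trivial_renormalization (- v') (- u') (- v) (- u) (- c) (\<lambda>x. - h (- x)) (\<lambda>x. - g (- x))"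

lemma trivial_step_enters:
  assumes "trivial_step u' v' u v c h g" "x \<in> {u'<..<v'} - {u<..<v}"
  shows "h x \<in> {u<..<v} \<and> x \<noteq> c"
  using assms(1) unfolding trivial_step_def
proof
  assume "trivial_renormalization u' v' u v c h g"
  then interpret trivial_renormalization u' v' u v c h g .
  show ?thesis using enters[of x] assms(2) v_eq g.crit by auto
next
  assume "trivial_renormalization (- v') (- u') (- v) (- u) (- c) (\<lambda>x. - h (- x)) (\<lambda>x. - g (- x))"
  then interpret trivial_renormalization "- v'" "- u'" "- v" "- u" "- c" "\<lambda>x. - h (- x)" "\<lambda>x. - g (- x)" .
  show ?thesis using enters[of "- x"] assms(2) v_eq g.crit by auto
qed

text \<open>One gap is unchanged and the other grows. Their sum is symmetric under reflection, so it
  increases for either kind of step and along mixed sequences of them.\<close>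

lemma trivial_step_gap:
  assumes "trivial_step u' v' u v c h g" "x \<in> {u<..<c}" "y \<in> {c<..<v}"
  shows "(v' - h x) + (h y - u') < (v - g x) + (g y - u)"
  using assms(1) unfolding trivial_step_def
proof
  assume "trivial_renormalization u' v' u v c h g"
  then interpret trivial_renormalization u' v' u v c h g .
  show ?thesis using gap_left[of x] gap_right[of y] assms(2,3) by auto
next
  assume "trivial_renormalization (- v') (- u') (- v) (- u) (- c) (\<lambda>x. - h (- x)) (\<lambda>x. - g (- x))"
  then interpret trivial_renormalization "- v'" "- u'" "- v" "- u" "- c" "\<lambda>x. - h (- x)" "\<lambda>x. - g (- x)" .
  show ?thesis using gap_left[of "- y"] gap_right[of "- x"] assms(2,3) by auto
qed

text \<open>An orbit point in (u', v') but outside (u, v) is moved into (u, v) by \<open>h\<close>,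
  which acts there as an iterate of \<open>f\<close>; so an orbit avoiding the smaller interval
  avoids the larger one.\<close>

lemma trivial_step_J_set:
  assumes step: "trivial_step u' v' u v c h g" and bt: "branch_times f c l r u' v' h"
    and sub: "u' \<le> u" "v \<le> v'"
  shows "J_set f u v = J_set f u' v'"
proof
  show "J_set f u' v' \<subseteq> J_set f u v"
    using sub by (fastforce simp: J_set_def)
  show "J_set f u v \<subseteq> J_set f u' v'"
  proof
    fix x assume x: "x \<in> J_set f u v"
    have "(f ^^ k) x \<notin> {u'<..<v'}" for k
    proof
      let ?y = "(f ^^ k) x"
      assume y: "?y \<in> {u'<..<v'}"
      have avoid: "(f ^^ j) ?y \<notin> {u<..<v}" for j
      proof -
        have "(f ^^ j) ?y = (f ^^ (j + k)) x" by (simp add: funpow_add)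
        then show ?thesis using x unfolding J_set_def Orb_def by blast
      qed
      from avoid[of 0] have "h ?y \<in> {u<..<v}" "?y \<noteq> c"
        using trivial_step_enters[OF step, of ?y] y by auto
      moreover obtain j where "h ?y = (f ^^ j) ?y"
        using bt y \<open>?y \<noteq> c\<close> by (cases ?y c rule: linorder_cases) (auto simp: branch_times_def reaches_def)
      ultimately show False using avoid[of j] by metis
    qed
    then show "x \<in> J_set f u' v'"
      using x by (auto simp: J_set_def Orb_def)
  qed
qed

lemma branch_times_one_two:
  assumes "trivial_renormalization u' v' u v c h g" "branch_times f c l r u' v' h"
  shows "branch_times f c l (r + l) u v g"
proof -
  interpret trivial_renormalization u' v' u v c h g by fact
  have "reaches f c l x (g x)" if "u < x" "x < c" for x
    using assms(2) that sub by (auto simp: branch_times_def eq_left)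
  moreover have "reaches f c (r + l) x (g x)" if "c < x" "x < v" for x
  proof (rule reaches_trans)
    show "reaches f c r x (h x)" using assms(2) that by (auto simp: branch_times_def v_eq)
    show "reaches f c l (h x) (g x)"
      using assms(2) that h_right[of x] by (auto simp: branch_times_def eq_right)
  qed
  ultimately show ?thesis by (auto simp: branch_times_def)
qed

lemma branch_times_two_one:
  assumes "trivial_renormalization (- v') (- u') (- v) (- u) (- c) (\<lambda>x. - h (- x)) (\<lambda>x. - g (- x))"
    and "branch_times f c l r u' v' h"
  shows "branch_times f c (l + r) r u v g"
proof -
  interpret trivial_renormalization "- v'" "- u'" "- v" "- u" "- c" "\<lambda>x. - h (- x)" "\<lambda>x. - g (- x)"
    by fact
  have "reaches f c r x (g x)" if "c < x" "x < v" for x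
    using assms(2) that sub eq_left[of "- x"] by (auto simp: branch_times_def)
  moreover have "reaches f c (l + r) x (g x)" if "u < x" "x < c" for x
  proof (rule reaches_trans)
    show "reaches f c l x (h x)" using assms(2) that v_eq by (auto simp: branch_times_def)
    show "reaches f c r (h x) (g x)"
      using assms(2) that h_right[of "- x"] eq_right[of "- x"] by (auto simp: branch_times_def)
  qed
  ultimately show ?thesis by (auto simp: branch_times_def)
qed

text \<open>A double step forces v = h v', while a trivial one has v = v' and h v \<le> c <
  v.\<close>

lemma trivial_not_double:
  assumes "trivial_renormalization u' v' u v c h g" "double_renormalization u' v' u v c h g"
  shows False
proof -
  interpret t: trivial_renormalization u' v' u v c h g by fact
  interpret d: double_renormalization u' v' u v c h g by fact
  show False using d.endpoints(1) t.h_v_le t.v_eq t.g.crit by simp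
qed

lemma trivial_step_not_double:
  assumes "trivial_step u' v' u v c h g" "double_renormalization u' v' u v c h g"
  shows False
  using assms trivial_not_double double_renormalization.reflect
  unfolding trivial_step_def by blast

section \<open>From the given steps to the trichotomy\<close>

lemma lorenz_pair_cases:
  assumes h: "lorenz_branches u' v' c h"
  shows "lorenz_pair u' v' h c 1 2 u v g \<Longrightarrow> trivial_renormalization u' v' u v c h g"
    and "lorenz_pair u' v' h c 2 1 u v g \<Longrightarrow>
      trivial_renormalization (- v') (- u') (- v) (- u) (- c) (\<lambda>x. - h (- x)) (\<lambda>x. - g (- x))"
    and "lorenz_pair u' v' h c 2 2 u v g \<Longrightarrow> double_renormalization u' v' u v c h g"
proof -
  have basic: "lorenz_branches u v c g" "u' \<le> u" "v \<le> v'" if "lorenz_pair u' v' h c a b u v g" for a b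
    using that lorenz_on_branches[of u v g c] by (auto simp: lorenz_pair_def)
  show "trivial_renormalization u' v' u v c h g" if "lorenz_pair u' v' h c 1 2 u v g"
    using that basic[OF that] h
    by (intro trivial_renormalizationI) (auto simp: lorenz_pair_def numeral_2_eq_2)
  show "trivial_renormalization (- v') (- u') (- v) (- u) (- c) (\<lambda>x. - h (- x)) (\<lambda>x. - g (- x))"
    if "lorenz_pair u' v' h c 2 1 u v g"
    using that basic[OF that] h
    by (intro trivial_renormalizationI lorenz_branches.reflect) (auto simp: lorenz_pair_def numeral_2_eq_2)
  show "double_renormalization u' v' u v c h g" if "lorenz_pair u' v' h c 2 2 u v g"
    using that basic[OF that] h
    by (intro double_renormalization.intro double_renormalization_axioms.intro)
       (auto simp: lorenz_pair_def numeral_2_eq_2)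
qed

text \<open>As \<open>c\<close> lies strictly between the endpoints, removing it from the domain
  hides neither of them.\<close>

lemma interval_map_eqD:
  assumes "interval_map u v c g = interval_map u' v' c g'" "u < c" "c < v" "u' < c" "c < v'"
  shows "u = u'" "v = v'" "\<And>x. x \<in> {u..v} - {c} \<Longrightarrow> g x = g' x"
proof -
  have "dom (interval_map a b c k) = {a..b} - {c}" for a b k
    by (auto simp: interval_map_def)
  then have dom: "{u..v} - {c} = {u'..v'} - {c}" using assms(1) by metis
  have "u \<in> {u'..v'}" "u' \<in> {u..v}" "v \<in> {u'..v'}" "v' \<in> {u..v}"
    using dom assms by (smt (verit) DiffD1 DiffI atLeastAtMost_iff singletonD)+
  then show uv: "u = u'" "v = v'" by auto
  show "g x = g' x" if "x \<in> {u..v} - {c}" for x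
    using fun_cong[OF assms(1), of x] that uv by (auto simp: interval_map_def restrict_map_def)
qed

theorem theorem6p1:
  fixes f :: "real \<Rightarrow> real" and c :: real and n :: nat
    and F :: "nat \<Rightarrow> real \<Rightarrow> real" and u v :: "nat \<Rightarrow> real"
  assumes "expanding_lorenz f c"
    and "n \<ge> 1"
    and "F 0 = f" and "u 0 = 0" and "v 0 = 1"
    and "\<forall>i\<in>{1..n}.
           lorenz_pair (u (i - 1)) (v (i - 1)) (F (i - 1)) c 1 2 (u i) (v i) (F i) \<or>
           lorenz_pair (u (i - 1)) (v (i - 1)) (F (i - 1)) c 2 1 (u i) (v i) (F i) \<or>
           lorenz_pair (u (i - 1)) (v (i - 1)) (F (i - 1)) c 2 2 (u i) (v i) (F i)"
  defines "double \<equiv> \<lambda>i. lorenz_pair (u (i - 1)) (v (i - 1)) (F (i - 1)) c 2 2 (u i) (v i) (F i)"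
    and "J \<equiv> J_set f (u n) (v n)"
  shows "\<exists>l r :: nat \<Rightarrow> nat.
    (\<forall>i\<in>{1..n}. l i \<ge> 1 \<and> r i \<ge> 1 \<and> lorenz_pair 0 1 f c (l i) (r i) (u i) (v i) (F i)) \<and>
    ((\<forall>i\<in>{1..n}. \<not> double i) \<longrightarrow>
       J \<subseteq> {0, 1} \<and> l n \<noteq> r n) \<and>
    (double n \<longrightarrow>
       contains_periodic_orbit f J \<and>
       R_map f c J = interval_map (u n) (v n) c (F n) \<and>
       l n = r n) \<and>
    (\<not> double n \<and> (\<exists>i\<in>{1..<n}. double i) \<longrightarrow>
       contains_periodic_orbit f J \<and>
       R_map f c J \<noteq> interval_map (u n) (v n) c (F n) \<and>
       l n \<noteq> r n \<and>
       (\<exists>j\<in>{1..<n}. double j \<and> (\<forall>k\<in>{j<..<n}. \<not> double k) \<and>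
          R_map f c J = interval_map (u j) (v j) c (F j)))"
proof -
  have f_maps: "f ` {0..1} \<subseteq> {0..1}"
    using assms(1) by (auto simp: expanding_lorenz_def)
  have trivial_or_double: "trivial_step (u (i - 1)) (v (i - 1)) (u i) (v i) c (F (i - 1)) (F i)"
    if "i \<in> {1..n}" "\<not> double i" "lorenz_branches (u (i - 1)) (v (i - 1)) c (F (i - 1))" for i
    using assms(6)[rule_format, OF that(1)] that(2) lorenz_pair_cases[OF that(3)]
    by (auto simp: double_def trivial_step_def)
  have br: "lorenz_branches (u i) (v i) c (F i)" if "i \<le> n" for i
  proof (cases i)
    case 0
    then show ?thesis using expanding_lorenz_branches[OF assms(1)] assms by simp
  next
    case (Suc k)
    then show ?thesis
      using assms(6)[rule_format, of i] that by (auto simp: lorenz_pair_def intro: lorenz_on_branches)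
  qed
  have sub: "u (i - 1) \<le> u i \<and> v i \<le> v (i - 1)" if "i \<in> {1..n}" for i
    using assms(6)[rule_format, OF that] by (auto simp: lorenz_pair_def)
  have nest: "u i \<le> u k \<and> v k \<le> v i" if "i \<le> k" "k \<le> n" for i k
    using that
  proof (induction k rule: dec_induct)
    case (step k)
    then show ?case using sub[of "Suc k"] by auto
  qed simp
  have tr: "trivial_step (u (i - 1)) (v (i - 1)) (u i) (v i) c (F (i - 1)) (F i)"
    if "i \<in> {1..n}" "\<not> double i" for i
    using trivial_or_double[OF that br] that by auto
  have db: "double_renormalization (u (i - 1)) (v (i - 1)) (u i) (v i) c (F (i - 1)) (F i)"
    if "i \<in> {1..n}" "double i" for i
    using lorenz_pair_cases(3)[OF br[of "i - 1"]] that by (auto simp: double_def)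
  \<comment> \<open>A double step makes both times equal to their sum; a trivial one adds a positive
    time to the other, so the results differ whatever came before. The guard excludes i = 0, where
    both times are 1 without any step.\<close>
  have "\<exists>l r. 1 \<le> l \<and> 1 \<le> r \<and> branch_times f c l r (u i) (v i) (F i) \<and> (1 \<le> i \<longrightarrow> (double i \<longleftrightarrow> l = r))"
    if "i \<le> n" for i
    using that
  proof (induction i)
    case 0
    have "branch_times f c 1 1 (u 0) (v 0) (F 0)"
      using assms by (auto simp: branch_times_def reaches_def)
    then show ?case by (metis le_refl not_one_le_zero)
  next
    case (Suc i)
    then obtain l r where lr: "1 \<le> l" "1 \<le> r" and bt: "branch_times f c l r (u i) (v i) (F i)"
      by auto
    have i: "Suc i \<in> {1..n}" using Suc.prems by simp
    show ?case
    proof (cases "double (Suc i)")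
      case True
      then show ?thesis
        using branch_times_double[OF _ bt] db[OF i] lr
        by (intro exI[of _ "l + r"] conjI) auto
    next
      case False
      then consider
          "trivial_renormalization (u i) (v i) (u (Suc i)) (v (Suc i)) c (F i) (F (Suc i))"
        | "trivial_renormalization (- v i) (- u i) (- v (Suc i)) (- u (Suc i)) (- c)
             (\<lambda>x. - F i (- x)) (\<lambda>x. - F (Suc i) (- x))"
        using tr[OF i] by (auto simp: trivial_step_def)
      then show ?thesis
      proof cases
        case 1
        then show ?thesis
          using branch_times_one_two[OF _ bt] lr False
          by (intro exI[of _ l] exI[of _ "r + l"] conjI) auto
      next
        case 2
        then show ?thesis
          using branch_times_two_one[OF _ bt] lr False
          by (intro exI[of _ "l + r"] exI[of _ r] conjI) auto
      qed
    qed
  qed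
  then obtain l r where lr: "\<And>i. i \<le> n \<Longrightarrow> 1 \<le> l i" "\<And>i. i \<le> n \<Longrightarrow> 1 \<le> r i"
      and bt: "\<And>i. i \<le> n \<Longrightarrow> branch_times f c (l i) (r i) (u i) (v i) (F i)"
      and lr_eq: "\<And>i. i \<in> {1..n} \<Longrightarrow> double i \<longleftrightarrow> l i = r i"
    by (metis atLeastAtMost_iff)
  have pair: "lorenz_pair 0 1 f c (l i) (r i) (u i) (v i) (F i)" if "i \<in> {1..n}" for i
  proof -
    have "i \<le> n" using that by simp
    have "lorenz_on (u i) (v i) (F i) c"
      using assms(6)[rule_format, OF that] by (auto simp: lorenz_pair_def)
    moreover have "{u i..v i} \<subseteq> {0..1}"
      using nest[of 0 i] \<open>i \<le> n\<close> assms by auto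
    moreover have "u i < c" "c < v i"
      using lorenz_branches.crit[OF br[OF \<open>i \<le> n\<close>]] by auto
    ultimately show ?thesis
      using lr \<open>i \<le> n\<close> bt[OF \<open>i \<le> n\<close>] branch_times_limits(1,2)[OF br bt, of i]
      unfolding lorenz_pair_def by (auto simp: branch_times_def reaches_def)
  qed
  \<comment> \<open>Trivial steps preserve J, so J can be computed at the last double step, or at
    [0,1] if there is none.\<close>
  have J_eq: "J_set f (u k) (v k) = J_set f (u i) (v i)"
    if "i \<le> k" "k \<le> n" "\<forall>j\<in>{i<..k}. \<not> double j" for i k
    using that
  proof (induction k rule: dec_induct)
    case (step k)
    then have "J_set f (u (Suc k)) (v (Suc k)) = J_set f (u k) (v k)"
      using trivial_step_J_set[OF tr[of "Suc k"]] bt[of k] sub[of "Suc k"] by auto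
    then show ?case using step by simp
  qed simp
  have main: "contains_periodic_orbit f (J_set f (u i) (v i)) \<and>
      R_map f c (J_set f (u i) (v i)) = interval_map (u i) (v i) c (F i)"
    if "i \<in> {1..n}" "double i" for i
  proof -
    have "i - 1 \<le> n" using that by auto
    then have "1 \<le> l (i - 1)" "0 \<le> u (i - 1)" "v (i - 1) \<le> 1"
      using lr nest[of 0 "i - 1"] assms by auto
    then show ?thesis
      using double_renormalization_J_set[OF db[OF that] bt[OF \<open>i - 1 \<le> n\<close>] f_maps] by simp
  qed
  have differ: "interval_map (u j) (v j) c (F j) \<noteq> interval_map (u n) (v n) c (F n)"
    if j: "j < n" "\<forall>k\<in>{j<..n}. \<not> double k" for j
  proof
    assume eq: "interval_map (u j) (v j) c (F j) = interval_map (u n) (v n) c (F n)"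
    \<comment> \<open>By nesting, \<open>x\<close> and \<open>y\<close> lie inside the left and
      right branch of every intermediate map, so all the gaps can be compared at these two
      points.\<close>
    define x where "x = (u n + c) / 2"
    define y where "y = (c + v n) / 2"
    have crit: "u n < c" "c < v n" "u j < c" "c < v j"
      using lorenz_branches.crit[OF br] j by auto
    then have x: "u n < x" "x < c" and y: "c < y" "y < v n" by (auto simp: x_def y_def)
    define gap where "gap = (\<lambda>i. (v i - F i x) + (F i y - u i))"
    have gap_Suc: "gap k < gap (Suc k)" if "j \<le> k" "k < n" for k
      using trivial_step_gap[OF tr[of "Suc k"], of x y] that j x y nest[of "Suc k" n]
      by (auto simp: gap_def)
    have "gap j < gap k" if "Suc j \<le> k" "k \<le> n" for k
      using that
    proof (induction k rule: dec_induct)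
      case base
      then show ?case using gap_Suc[of j] j by simp
    next
      case (step k)
      then show ?case using gap_Suc[of k] by simp
    qed
    then have "gap j < gap n" using j by simp
    moreover have "u j = u n" "v j = v n" "F j x = F n x" "F j y = F n y"
      using interval_map_eqD[OF eq crit(3,4,1,2)] x y by auto
    ultimately show False by (simp add: gap_def)
  qed
  have n: "n \<in> {1..n}" using assms(2) by simp
  have "J \<subseteq> {0, 1}" if "\<forall>i\<in>{1..n}. \<not> double i"
  proof -
    have "J = J_set f 0 1"
      using J_eq[of 0 n] that assms(4,5) by (auto simp: J_def)
    also have "\<dots> \<subseteq> {0, 1}"
      \<comment> \<open>The orbit of a point contains the point itself, so no point of (0,1) belongs
        to this set.\<close>
      using J_set_hole[of f 0 1] by (force simp: J_set_def)
    finally show ?thesis .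
  qed
  moreover have "contains_periodic_orbit f J \<and>
      R_map f c J \<noteq> interval_map (u n) (v n) c (F n) \<and> l n \<noteq> r n \<and>
      (\<exists>j\<in>{1..<n}. double j \<and> (\<forall>k\<in>{j<..<n}. \<not> double k) \<and>
        R_map f c J = interval_map (u j) (v j) c (F j))"
    if last: "\<not> double n" and ex: "\<exists>i\<in>{1..<n}. double i"
  proof -
    define D where "D = {i \<in> {1..<n}. double i}"
    \<comment> \<open>The last double step: all steps after it, including step \<open>n\<close>, are
      trivial.\<close>
    define j where "j = Max D"
    have D: "finite D" "D \<noteq> {}" using ex by (auto simp: D_def)
    then have j: "j \<in> {1..<n}" "double j"
      using Max_in[OF D] by (auto simp: D_def j_def)
    have above: "\<not> double k" if "k \<in> {j<..n}" for k
    proof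
      assume "double k"
      then have "k \<in> D" using that last j by (cases "k = n") (auto simp: D_def)
      then show False using Max_ge[OF D(1), of k] that by (simp add: j_def)
    qed
    then have J: "J = J_set f (u j) (v j)"
      using J_eq[of j n] j by (simp add: J_def)
    have "j \<in> {1..n}" using j by simp
    from main[OF this j(2)] have R: "contains_periodic_orbit f J"
        "R_map f c J = interval_map (u j) (v j) c (F j)"
      by (simp_all add: J)
    moreover have "R_map f c J \<noteq> interval_map (u n) (v n) c (F n)"
      using differ[of j] above j R(2) by auto
    moreover have "l n \<noteq> r n" using lr_eq[OF n] last by simp
    ultimately show ?thesis using j above by (auto intro!: bexI[of _ j])
  qed
  ultimately show ?thesis
    using lr pair lr_eq n main[OF n] 
    by (intro exI[of _ l] exI[of _ r] conjI) (auto simp: J_def)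
qed

end
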